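(* Let $n\geq 2$. The inclusion $PO_n\subset PU_n$ is maximal in the category of compact groups: if $G$ is a compact subgroup of $PU_n$ with $PO_n\subset G\subset PU_n$, then $G=PO_n$ or $G=PU_n$.
   Context: $U_n$ is the group of unitary $n\times n$ complex matrices and $O_n\subset U_n$ is the group of real orthogonal matrices. $\mathbb T\subset U_n$ denotes the group of norm one complex multiples of the identity. For a closed subgroup $G\subset U_n$, $PG=G/(G\cap\mathbb T)$; thus $PU_n=U_n/\mathbb T$, and $PO_n=O_n/(O_n\cap\mathbb T)$ is identified with the image of $O_n$ under the quotient map $U_n\to PU_n$. *)

theory Defs
  imports "HOL-Analysis.Analysis" "HOL-Algebra.Coset"
begin

text \<open>\<open>n \<times> n\<close> complex matrices are elements of \<open>complex ^ 'n ^ 'n\<close> with \<open>n = CARD('n)\<close>;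
  the topology on them is the Euclidean one of the type.\<close>

definition conj_transpose :: "complex ^ 'n ^ 'm \<Rightarrow> complex ^ 'm ^ 'n" where
  "conj_transpose A = map_matrix cnj (transpose A)"

definition unitary_matrix :: "complex ^ 'n ^ 'n \<Rightarrow> bool" where
  "unitary_matrix A \<longleftrightarrow> conj_transpose A ** A = mat 1 \<and> A ** conj_transpose A = mat 1"

definition unitary_group :: "(complex ^ 'n ^ 'n) monoid" where
  "unitary_group = \<lparr>carrier = {A. unitary_matrix A}, mult = (**), one = mat 1\<rparr>"

definition scalar_unitaries :: "(complex ^ 'n ^ 'n) set" where
  "scalar_unitaries = {mat z |z. cmod z = 1}"

definition orthogonal_in_unitary :: "(complex ^ 'n ^ 'n) set" where
  "orthogonal_in_unitary = map_matrix complex_of_real ` {Q :: real ^ 'n ^ 'n. orthogonal_matrix Q}"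

definition projective_unitary_group :: "(complex ^ 'n ^ 'n) set monoid" where
  "projective_unitary_group = unitary_group Mod scalar_unitaries"

definition projectivization :: "complex ^ 'n ^ 'n \<Rightarrow> (complex ^ 'n ^ 'n) set" where
  "projectivization A = scalar_unitaries #>\<^bsub>unitary_group\<^esub> A"

text \<open>The quotient topology; that it is one, and that it makes \<open>projectivization\<close> a quotient
  map, is \<open>quotient_map_projectivization\<close> below.\<close>

definition projective_unitary_topology :: "(complex ^ 'n ^ 'n) set topology" where
  "projective_unitary_topology = topology (\<lambda>W. W \<subseteq> carrier projective_unitary_group \<and>
     openin (top_of_set (carrier unitary_group))
       {A \<in> carrier unitary_group. projectivization A \<in> W})"

text \<open>The image of the orthogonal group in the projective unitary group, that is, the copy of
  \<open>O\<^sub>n / (O\<^sub>n \<inter> \<T>)\<close> inside it.\<close>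

definition projective_orthogonal :: "(complex ^ 'n ^ 'n) set set" where
  "projective_orthogonal = projectivization ` orthogonal_in_unitary"


lemma carrier_unitary_group [simp]: "A \<in> carrier unitary_group \<longleftrightarrow> unitary_matrix A"
  and mult_unitary_group [simp]: "mult unitary_group = (**)"
  and one_unitary_group [simp]: "one unitary_group = mat 1"
  by (auto simp: unitary_group_def)

lemma conj_transpose_mult: "conj_transpose (A ** B) = conj_transpose B ** conj_transpose A"
  by (simp add: conj_transpose_def transpose_def matrix_matrix_mult_def vec_eq_iff mult.commute)

lemma conj_transpose_conj_transpose [simp]: "conj_transpose (conj_transpose A) = A"
  by (simp add: conj_transpose_def transpose_def vec_eq_iff)

lemma conj_transpose_mat [simp]: "conj_transpose (mat z) = mat (cnj z)"
  by (auto simp: conj_transpose_def transpose_def mat_def vec_eq_iff)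

lemma mat_mult_nth [simp]: "(mat z ** A) $ i $ j = z * (A :: complex ^ 'n ^ 'n) $ i $ j"
  by (simp add: mat_def matrix_matrix_mult_def if_distrib if_distribR sum.delta cong: if_cong)

lemma mult_mat_nth [simp]: "(A ** mat z) $ i $ j = (A :: complex ^ 'n ^ 'n) $ i $ j * z"
  by (simp add: mat_def matrix_matrix_mult_def if_distrib if_distribR sum.delta cong: if_cong)

lemma mat_commute: "mat z ** A = (A :: complex ^ 'n ^ 'n) ** mat z"
  by (simp add: vec_eq_iff mult.commute)

lemma mat_mult_mat: "(mat z :: complex ^ 'n ^ 'n) ** mat w = mat (z * w)"
  unfolding vec_eq_iff mat_mult_nth by (simp add: mat_def)

lemma unitary_matrix_mult: "unitary_matrix A \<Longrightarrow> unitary_matrix B \<Longrightarrow> unitary_matrix (A ** B)"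
proof -
  assume A: "unitary_matrix A" and B: "unitary_matrix B"
  have "conj_transpose (A ** B) ** (A ** B) = conj_transpose B ** (conj_transpose A ** A) ** B"
    and "(A ** B) ** conj_transpose (A ** B) = A ** (B ** conj_transpose B) ** conj_transpose A"
    by (simp_all only: conj_transpose_mult matrix_mul_assoc)
  with A B show ?thesis by (simp add: unitary_matrix_def)
qed

lemma unitary_matrix_one [simp]: "unitary_matrix (mat 1)"
  by (simp add: unitary_matrix_def)

lemma group_unitary_group: "group (unitary_group :: (complex ^ 'n ^ 'n) monoid)"
proof (rule groupI)
  fix A :: "complex ^ 'n ^ 'n"
  assume "A \<in> carrier unitary_group"
  then show "\<exists>B\<in>carrier unitary_group. B \<otimes>\<^bsub>unitary_group\<^esub> A = \<one>\<^bsub>unitary_group\<^esub>"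
    by (intro bexI[of _ "conj_transpose A"]) (auto simp: unitary_matrix_def)
qed (auto simp: matrix_mul_assoc unitary_matrix_mult)

lemma scalar_unitaries_unitary: "A \<in> scalar_unitaries \<Longrightarrow> unitary_matrix A"
proof -
  assume "A \<in> scalar_unitaries"
  then obtain z where z: "A = mat z" "cmod z = 1" by (auto simp: scalar_unitaries_def)
  have "z * cnj z = 1" "cnj z * z = 1"
    using z(2) complex_norm_square[of z] by (simp_all add: mult.commute)
  with z show ?thesis by (simp add: unitary_matrix_def mat_mult_mat)
qed

lemma normal_scalar_unitaries: "scalar_unitaries \<lhd> (unitary_group :: (complex ^ 'n ^ 'n) monoid)"
proof -
  interpret group "unitary_group :: (complex ^ 'n ^ 'n) monoid" by (rule group_unitary_group)
  have "subgroup scalar_unitaries (unitary_group :: (complex ^ 'n ^ 'n) monoid)"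
  proof (rule subgroupI)
    fix A :: "complex ^ 'n ^ 'n" assume A: "A \<in> scalar_unitaries"
    then obtain z where z: "A = mat z" "cmod z = 1" by (auto simp: scalar_unitaries_def)
    have "inv\<^bsub>unitary_group\<^esub> A = conj_transpose A"
      using scalar_unitaries_unitary[OF A] by (intro inv_equality) (auto simp: unitary_matrix_def)
    then show "inv\<^bsub>unitary_group\<^esub> A \<in> scalar_unitaries"
      using z by (auto simp: scalar_unitaries_def)
  next
    have "mat 1 \<in> scalar_unitaries" unfolding scalar_unitaries_def by fastforce
    then show "scalar_unitaries \<noteq> {}" by blast
  next
    show "A \<otimes>\<^bsub>unitary_group\<^esub> B \<in> scalar_unitaries"
      if "A \<in> scalar_unitaries" "B \<in> scalar_unitaries" for A B :: "complex ^ 'n ^ 'n"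
      using that by (force simp: scalar_unitaries_def mat_mult_mat norm_mult)
  qed (auto simp: scalar_unitaries_unitary)
  then show ?thesis
    by (rule normalI)
      (auto simp: r_coset_def l_coset_def scalar_unitaries_def mat_commute)
qed

lemma group_projective_unitary_group: "group projective_unitary_group"
  unfolding projective_unitary_group_def
  by (rule normal.factorgroup_is_group[OF normal_scalar_unitaries])

lemma projectivization_hom: "projectivization \<in> hom unitary_group projective_unitary_group"
  using normal.r_coset_hom_Mod[OF normal_scalar_unitaries]
  by (simp add: projectivization_def[abs_def] projective_unitary_group_def)

lemma carrier_projective_unitary_group:
  "carrier projective_unitary_group = projectivization ` carrier unitary_group"
  by (auto simp: projective_unitary_group_def carrier_FactGroup projectivization_def[abs_def])

lemma openin_projective_unitary_topology:
  fixes W :: "(complex ^ 'n ^ 'n) set set"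
  shows "openin projective_unitary_topology W \<longleftrightarrow> W \<subseteq> carrier projective_unitary_group \<and>
     openin (top_of_set (carrier unitary_group))
       {A \<in> carrier unitary_group. projectivization A \<in> W}"
proof -
  let ?pre = "\<lambda>W :: (complex ^ 'n ^ 'n) set set. {A \<in> carrier unitary_group. projectivization A \<in> W}"
  have "istopology (\<lambda>W :: (complex ^ 'n ^ 'n) set set. W \<subseteq> carrier projective_unitary_group \<and>
          openin (top_of_set (carrier unitary_group)) (?pre W))"
    unfolding istopology_def
  proof (intro conjI allI impI)
    fix S T :: "(complex ^ 'n ^ 'n) set set"
    assume "S \<subseteq> carrier projective_unitary_group \<and>
        openin (top_of_set (carrier unitary_group)) (?pre S)"
      and "T \<subseteq> carrier projective_unitary_group \<and>
        openin (top_of_set (carrier unitary_group)) (?pre T)"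
    moreover have "?pre (S \<inter> T) = ?pre S \<inter> ?pre T" by auto
    ultimately show "openin (top_of_set (carrier unitary_group)) (?pre (S \<inter> T))"
      and "S \<inter> T \<subseteq> carrier projective_unitary_group"
      by (auto simp del: carrier_unitary_group)
  next
    fix K :: "(complex ^ 'n ^ 'n) set set set"
    assume K: "\<forall>S\<in>K. S \<subseteq> carrier projective_unitary_group \<and>
        openin (top_of_set (carrier unitary_group)) (?pre S)"
    then show "\<Union>K \<subseteq> carrier projective_unitary_group" by blast
    have "?pre (\<Union>K) = (\<Union>S\<in>K. ?pre S)" by auto
    then show "openin (top_of_set (carrier unitary_group)) (?pre (\<Union>K))"
      using K by (auto simp del: carrier_unitary_group)
  qed
  then show ?thesis
    by (simp add: projective_unitary_topology_def topology_inverse')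
qed

lemma topspace_projective_unitary_topology [simp]:
  "topspace projective_unitary_topology =
    carrier (projective_unitary_group :: (complex ^ 'n ^ 'n) set monoid)"
  (is "_ = carrier ?PU")
proof
  show "topspace projective_unitary_topology \<subseteq> carrier ?PU"
    unfolding topspace_def openin_projective_unitary_topology by blast
  have pre: "{A \<in> carrier unitary_group. projectivization A \<in> carrier ?PU}
      = carrier unitary_group"
    unfolding carrier_projective_unitary_group by blast
  have "openin projective_unitary_topology (carrier ?PU)"
    unfolding openin_projective_unitary_topology pre
    by (simp only: openin_subtopology_self order_refl simp_thms)
  then show "carrier ?PU \<subseteq> topspace projective_unitary_topology"
    by (rule openin_subset)
qed

lemma quotient_map_projectivization:
  "quotient_map (top_of_set (carrier unitary_group)) projective_unitary_topology projectivization"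
  unfolding quotient_map_def
  by (simp add: openin_projective_unitary_topology carrier_projective_unitary_group
      del: carrier_unitary_group)

lemma orthogonal_in_unitary_iff:
  fixes A :: "complex ^ 'n ^ 'n"
  shows "A \<in> orthogonal_in_unitary \<longleftrightarrow> unitary_matrix A \<and> (\<forall>i j. A $ i $ j \<in> \<real>)"
proof -
  have key: "unitary_matrix (map_matrix complex_of_real Q) \<longleftrightarrow> orthogonal_matrix Q"
    for Q :: "real ^ 'n ^ 'n"
  proof -
    have eq: "(\<Sum>k\<in>UNIV. complex_of_real (f k) * complex_of_real (g k)) = (if b then 1 else 0)
       \<longleftrightarrow> (\<Sum>k\<in>UNIV. f k * g k) = (if b then 1 else 0)" for f g :: "'n \<Rightarrow> real" and b
    proof -
      have "(\<Sum>k\<in>UNIV. complex_of_real (f k) * complex_of_real (g k))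
          = complex_of_real (\<Sum>k\<in>UNIV. f k * g k)"
        by (simp only: of_real_sum of_real_mult)
      moreover have "(if b then 1 else 0) = complex_of_real (if b then 1 else 0)"
        by (cases b) (simp_all only: if_True if_False of_real_1 of_real_0)
      ultimately show ?thesis
        by (simp only: of_real_eq_iff)
    qed
    show ?thesis
      by (simp add: unitary_matrix_def orthogonal_matrix_def conj_transpose_def transpose_def
          matrix_matrix_mult_def mat_def vec_eq_iff eq)
  qed
  show ?thesis
  proof
    assume "A \<in> orthogonal_in_unitary"
    then show "unitary_matrix A \<and> (\<forall>i j. A $ i $ j \<in> \<real>)"
      using key by (auto simp: orthogonal_in_unitary_def)
  next
    assume A: "unitary_matrix A \<and> (\<forall>i j. A $ i $ j \<in> \<real>)"
    then have "A = map_matrix complex_of_real (map_matrix Re A)"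
      by (simp add: vec_eq_iff of_real_Re)
    then show "A \<in> orthogonal_in_unitary"
      using A key unfolding orthogonal_in_unitary_def by (metis imageI mem_Collect_eq)
  qed
qed

lemma projective_orthogonal_subset: "projective_orthogonal \<subseteq> carrier projective_unitary_group"
  unfolding projective_orthogonal_def carrier_projective_unitary_group
  by (intro image_mono) (auto simp: orthogonal_in_unitary_iff)

end

theory Submission
  imports Defs
begin

text \<open>
  Pulled back to the unitary group, \<open>G\<close> becomes a group \<open>H\<close> of unitary matrices containing all
  real orthogonal matrices and all unitary scalars. If \<open>H\<close> consists of scalar multiples of
  orthogonal matrices, then \<open>G\<close> is the projective orthogonal group. Otherwise some \<open>U\<close> in \<open>H\<close> is
  not such a multiple, and \<open>H\<close> turns out to contain every unitary matrix.

  The argument replaces Lie algebras by reflections. Write \<open>R z = 1 - 2 z z\<^sup>*\<close> for a unit vector \<open>z\<close>.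
  For a real unit vector \<open>w\<close> the matrix \<open>R w\<close> is orthogonal, so \<open>H\<close> contains
  \<open>U (R w) U\<^sup>* = R (U w)\<close>. Up to a phase and an orthogonal change of coordinates, the complex unit
  vector \<open>z = U w\<close> is determined by the number \<open>\<bar>q z\<bar>\<close> in the interval from 0 to 1, where
  \<open>q z\<close> is the sum of the squares of the coordinates of \<open>z\<close>: the value 1 means that \<open>z\<close> is a
  phase times a real vector, the value 0 that its real and imaginary parts are orthogonal of equal
  length. If \<open>\<bar>q z\<bar> = cos \<theta>\<close>, one can move \<open>z\<close> to
  \<open>(exp (i \<theta> / 2) e\<^sub>j + exp (- i \<theta> / 2) e\<^sub>k) / sqrt 2\<close> (lemma \<open>move_to_phase_pair\<close>), and the
  product of that reflection with the real one for \<open>\<theta> = 0\<close> is the diagonal matrix, called a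
  twist below, with entries \<open>exp (i \<theta>)\<close> and \<open>exp (- i \<theta>)\<close> in the places \<open>j\<close> and \<open>k\<close> and 1
  elsewhere. So every value \<open>cos \<theta>\<close> of \<open>\<bar>q (U w)\<bar>\<close> puts the twists by \<open>\<theta>\<close> into \<open>H\<close>
  (lemma \<open>twist_in_if_cos\<close>).

  When \<open>n = 2\<close>, the twist by a right angle is the scalar \<open>i\<close> times an orthogonal matrix, so a value
  strictly between 0 and 1 is needed. It exists because the real unit sphere is connected and
  \<open>\<bar>q (U w)\<bar>\<close> is neither identically 0 (\<open>U\<close> is invertible) nor identically 1 (\<open>U\<close> is not a scalar
  times an orthogonal matrix); this is lemma \<open>intermediate_quad\<close>. Applying the construction a second
  time, now to the twist just found, yields a whole interval of angles containing 0, and powers of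
  these give all twists (lemma \<open>all_twists_in\<close>). Twists and scalars generate all diagonal
  unitaries, and a column by column elimination with diagonal matrices and real reflections writes
  any unitary matrix as a product of diagonal and orthogonal ones
  (lemma \<open>unitary_in_by_elimination\<close>).
\<close>

section \<open>Vectors, inner product and diagonal matrices\<close>

definition cvec :: "real ^ 'n \<Rightarrow> complex ^ 'n" where
  "cvec u = (\<chi> i. complex_of_real (u $ i))"

definition cinner :: "complex ^ 'n \<Rightarrow> complex ^ 'n \<Rightarrow> complex" where
  "cinner u v = (\<Sum>i\<in>UNIV. cnj (u $ i) * v $ i)"

definition diagonal :: "('n \<Rightarrow> complex) \<Rightarrow> complex ^ 'n ^ 'n" where
  "diagonal f = (\<chi> i j. if i = j then f i else 0)"

lemma cvec_nth [simp]: "cvec u $ i = complex_of_real (u $ i)"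
  by (simp add: cvec_def)

lemma cinner_cvec: "cinner (cvec u) (cvec v) = complex_of_real (u \<bullet> v)"
  by (simp add: cinner_def inner_vec_def)

lemma cinner_conj_transpose: "cinner (conj_transpose A *v u) v = cinner u (A *v v)"
proof -
  have "cinner (conj_transpose A *v u) v = (\<Sum>j\<in>UNIV. \<Sum>i\<in>UNIV. A $ i $ j * cnj (u $ i) * v $ j)"
    by (simp add: cinner_def conj_transpose_def transpose_def matrix_vector_mult_def sum_distrib_right)
  also have "\<dots> = (\<Sum>i\<in>UNIV. \<Sum>j\<in>UNIV. A $ i $ j * cnj (u $ i) * v $ j)"
    by (rule sum.swap)
  also have "\<dots> = cinner u (A *v v)"
    by (simp add: cinner_def matrix_vector_mult_def sum_distrib_left mult_ac)
  finally show ?thesis .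
qed

lemma cinner_unitary:
  assumes "unitary_matrix A"
  shows "cinner (A *v u) (A *v v) = cinner u v"
  using assms cinner_conj_transpose[of A "A *v u" v]
  by (simp add: unitary_matrix_def matrix_vector_mul_assoc)

lemma diagonal_mult_vec [simp]: "(diagonal f *v v) $ i = f i * v $ i"
proof -
  have "(diagonal f *v v) $ i = (\<Sum>j\<in>UNIV. if i = j then f i * v $ j else 0)"
    unfolding diagonal_def matrix_vector_mult_def vec_lambda_beta by (intro sum.cong) auto
  then show ?thesis by simp
qed

lemma diagonal_mult: "diagonal f ** diagonal g = diagonal (\<lambda>i. f i * g i)"
  unfolding matrix_eq by (simp add: vec_eq_iff flip: matrix_vector_mul_assoc)

lemma diagonal_const: "diagonal (\<lambda>_. c) = mat c"
  by (simp add: diagonal_def mat_def)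

lemma conj_transpose_diagonal: "conj_transpose (diagonal f) = diagonal (\<lambda>i. cnj (f i))"
  by (simp add: vec_eq_iff conj_transpose_def transpose_def diagonal_def)

lemma unitary_diagonal:
  assumes "\<And>i. cmod (f i) = 1"
  shows "unitary_matrix (diagonal f)"
proof -
  have "f i * cnj (f i) = 1" for i
    using assms[of i] complex_norm_square[of "f i"] by simp
  then show ?thesis
    by (simp add: unitary_matrix_def conj_transpose_diagonal diagonal_mult mult.commute
        flip: diagonal_const)
qed

section \<open>Complex reflections\<close>

definition refl_matrix :: "complex ^ 'n \<Rightarrow> complex ^ 'n ^ 'n" where
  "refl_matrix v = (\<chi> i j. (if i = j then 1 else 0) - 2 * v $ i * cnj (v $ j))"

lemma refl_matrix_mult_vec: "refl_matrix v *v u = u - (2 * cinner v u) *s v"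
proof -
  have "(refl_matrix v *v u) $ i = u $ i - 2 * cinner v u * v $ i" for i
  proof -
    have "(refl_matrix v *v u) $ i
        = (\<Sum>j\<in>UNIV. (if i = j then u $ j else 0) - 2 * v $ i * (cnj (v $ j) * u $ j))"
      unfolding refl_matrix_def matrix_vector_mult_def
      by (auto intro!: sum.cong simp: algebra_simps)
    then show ?thesis
      by (simp add: sum_subtractf cinner_def sum_distrib_left mult_ac)
  qed
  then show ?thesis by (simp add: vec_eq_iff)
qed

lemma conj_transpose_refl_matrix: "conj_transpose (refl_matrix v) = refl_matrix v"
  by (simp add: vec_eq_iff conj_transpose_def transpose_def refl_matrix_def mult_ac)

lemma cinner_diff_scale: "cinner v (u - c *s w) = cinner v u - c * cinner v w"
  by (simp add: cinner_def sum_subtractf sum_distrib_left algebra_simps)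

lemma unitary_refl_matrix:
  assumes "cinner v v = 1"
  shows "unitary_matrix (refl_matrix v)"
proof -
  have "refl_matrix v ** refl_matrix v = mat 1"
    unfolding matrix_eq
  proof
    fix u
    have "refl_matrix v *v (refl_matrix v *v u) = u"
      by (simp add: refl_matrix_mult_vec cinner_diff_scale assms vec_eq_iff)
    then show "(refl_matrix v ** refl_matrix v) *v u = mat 1 *v u"
      by (simp add: matrix_vector_mul_assoc)
  qed
  then show ?thesis by (simp add: unitary_matrix_def conj_transpose_refl_matrix)
qed

lemma refl_matrix_in_orthogonal:
  assumes "norm v = 1"
  shows "refl_matrix (cvec v) \<in> orthogonal_in_unitary"
proof -
  have "v \<bullet> v = 1" using assms by (simp add: norm_eq_1)
  then have "unitary_matrix (refl_matrix (cvec v))"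
    by (simp add: unitary_refl_matrix cinner_cvec)
  then show ?thesis
    by (simp add: orthogonal_in_unitary_iff) (simp add: refl_matrix_def)
qed

text \<open>Reflections are transported by unitary matrices like the vectors that define them. This is how
  an element \<open>A\<close> of the group and a real reflection produce a complex reflection in the group.\<close>

lemma conjugate_refl_matrix:
  assumes "unitary_matrix A"
  shows "A ** refl_matrix v ** conj_transpose A = refl_matrix (A *v v)"
  unfolding matrix_eq
proof
  fix u
  have "A *v (conj_transpose A *v u) = u"
    using assms by (simp add: matrix_vector_mul_assoc unitary_matrix_def)
  moreover have "cinner v (conj_transpose A *v u) = cinner (A *v v) u"
    using cinner_conj_transpose[of "conj_transpose A" v u] by simp
  ultimately have "A *v (refl_matrix v *v (conj_transpose A *v u)) = refl_matrix (A *v v) *v u"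
    by (simp add: refl_matrix_mult_vec matrix_vector_mult_diff_distrib matrix_vector_mult_scaleR
        vector_scalar_commute)
  then show "(A ** refl_matrix v ** conj_transpose A) *v u = refl_matrix (A *v v) *v u"
    by (simp add: matrix_vector_mul_assoc matrix_mul_assoc)
qed

lemma refl_matrix_phase:
  assumes "cmod c = 1"
  shows "refl_matrix (c *s v) = refl_matrix v"
proof -
  have "c * cnj c = 1" using assms complex_norm_square[of c] by simp
  then have "(c * x) * cnj (c * y) = x * cnj y" for x y
    by (simp add: mult_ac)
  then have "2 * (c * x) * cnj (c * y) = 2 * x * cnj y" for x y
    by (metis mult.assoc)
  then show ?thesis by (simp only: refl_matrix_def vector_smult_component)
qed

section \<open>Transporting real vectors by orthogonal maps\<close>

lemma complexify_orthogonal_transformation: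
  fixes f :: "real ^ 'n \<Rightarrow> real ^ 'n"
  assumes "orthogonal_transformation f"
  obtains A where "A \<in> orthogonal_in_unitary" "\<And>u. A *v cvec u = cvec (f u)"
proof
  let ?A = "map_matrix complex_of_real (matrix f)"
  show "?A \<in> orthogonal_in_unitary"
    using assms by (simp add: orthogonal_in_unitary_def orthogonal_transformation_matrix)
  fix u
  have "f u = matrix f *v u"
    using assms by (simp add: orthogonal_transformation_def matrix_works)
  then show "?A *v cvec u = cvec (f u)"
    by (simp add: vec_eq_iff matrix_vector_mult_def)
qed

text \<open>The map is the reflection in the hyperplane orthogonal to \<open>a - b\<close>, the identity if \<open>a = b\<close> (where
  the division by zero below yields zero). That it fixes this hyperplane is what allows a second vector,
  or the earlier columns of a matrix, to be left in place.\<close>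

lemma householder:
  fixes a b :: "'a :: real_inner"
  assumes "norm a = norm b"
  obtains f where "orthogonal_transformation f" "f a = b" "\<And>u. u \<bullet> (a - b) = 0 \<Longrightarrow> f u = u"
proof
  define d where "d = a - b"
  define f where "f u = u - (2 * (u \<bullet> d) / (d \<bullet> d)) *\<^sub>R d" for u
  have "linear f"
    by (rule linearI) (simp_all add: f_def inner_add_left algebra_simps add_divide_distrib)
  moreover have "f u \<bullet> f v = u \<bullet> v" for u v
    by (cases "d = 0") (simp_all add: f_def inner_diff inner_commute field_simps)
  ultimately show "orthogonal_transformation f"
    by (simp add: orthogonal_transformation_def)
  have "a \<bullet> a = b \<bullet> b" using assms by (simp add: norm_eq)
  then have "2 * (a \<bullet> d) = d \<bullet> d" by (simp add: d_def inner_diff inner_commute)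
  then show "f a = b" by (cases "d = 0") (simp_all add: f_def d_def)
  show "f u = u" if "u \<bullet> (a - b) = 0" for u using that by (simp add: f_def d_def)
qed

text \<open>Two reflections suffice: the one moving the second vector is along a difference of vectors
  orthogonal to \<open>x'\<close>, hence keeps \<open>x'\<close>.\<close>

lemma orthogonal_pair_transport:
  fixes x y x' y' :: "'a :: real_inner"
  assumes "x \<bullet> y = 0" "x' \<bullet> y' = 0" "norm x = norm x'" "norm y = norm y'"
  obtains f where "orthogonal_transformation f" "f x = x'" "f y = y'"
proof -
  obtain g where g: "orthogonal_transformation g" "g x = x'"
    using householder[OF assms(3)] by blast
  have "norm (g y) = norm y'" using g(1) assms(4) by (simp add: orthogonal_transformation_norm)
  then obtain h where h: "orthogonal_transformation h" "h (g y) = y'"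
      "\<And>u. u \<bullet> (g y - y') = 0 \<Longrightarrow> h u = u"
    using householder by blast
  have "x' \<bullet> g y = 0" using g assms(1) unfolding orthogonal_transformation_def by metis
  then have "h x' = x'" using assms(2) by (intro h(3)) (simp add: inner_diff_right)
  then have "(h \<circ> g) x = x'" "(h \<circ> g) y = y'" using g h by auto
  moreover have "orthogonal_transformation (h \<circ> g)"
    using g h by (simp add: orthogonal_transformation_compose)
  ultimately show ?thesis using that by blast
qed

section \<open>Twists as products of two reflections\<close>

lemma sum_two_points:
  fixes a b :: "'b :: comm_monoid_add" and j k :: "'n :: finite"
  assumes "j \<noteq> k"
  shows "(\<Sum>i\<in>UNIV. if i = j then a else if i = k then b else 0) = a + b"
proof -
  have "(\<Sum>i\<in>UNIV. if i = j then a else if i = k then b else 0)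
      = (\<Sum>i\<in>UNIV. (if i = j then a else 0) + (if i = k then b else 0))"
    using assms by (intro sum.cong) auto
  then show ?thesis by (simp add: sum.distrib)
qed

definition half_sum :: "'n :: finite \<Rightarrow> 'n \<Rightarrow> real ^ 'n" where
  "half_sum j k = (1 / sqrt 2) *\<^sub>R (axis j 1 + axis k 1)"

lemma norm_half_sum:
  assumes "j \<noteq> k"
  shows "norm (half_sum j k) = 1"
proof -
  have "half_sum j k \<bullet> half_sum j k = 1"
    using assms by (simp add: half_sum_def inner_add_left inner_add_right inner_axis_axis)
  then show ?thesis by (simp add: norm_eq_1)
qed

lemma cvec_axis: "cvec (axis i 1) = axis i 1"
  by (simp add: vec_eq_iff axis_def)

lemma mult_cvec_axis: "(U *v cvec (axis j 1)) $ i = U $ i $ j"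
  by (simp add: matrix_vector_mult_def axis_def if_distrib cong: if_cong)

lemma mult_cvec_half_sum:
  "(U *v cvec (half_sum j k)) $ i = complex_of_real (1 / sqrt 2) * (U $ i $ j + U $ i $ k)"
proof -
  have "cvec (half_sum j k) = complex_of_real (1 / sqrt 2) *s (cvec (axis j 1) + cvec (axis k 1))"
    by (simp add: vec_eq_iff half_sum_def add_divide_distrib)
  then show ?thesis
    by (simp only: vector_scalar_commute matrix_vector_right_distrib vector_smult_component
        vector_add_component mult_cvec_axis)
qed

definition twist :: "'n \<Rightarrow> 'n \<Rightarrow> real \<Rightarrow> complex ^ 'n ^ 'n" where
  "twist j k \<theta> = diagonal (\<lambda>i. if i = j then cis \<theta> else if i = k then cis (- \<theta>) else 1)"

text \<open>The normal form of a complex unit vector under phases and real orthogonal maps.\<close>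

definition phase_pair :: "'n \<Rightarrow> 'n \<Rightarrow> real \<Rightarrow> complex ^ 'n" where
  "phase_pair j k \<phi> = (\<chi> i. if i = j then cis \<phi> / sqrt 2 else if i = k then cis (- \<phi>) / sqrt 2 else 0)"

lemma phase_pair_nth:
  "phase_pair j k \<phi> $ i = (if i = j then cis \<phi> / sqrt 2 else if i = k then cis (- \<phi>) / sqrt 2 else 0)"
  by (simp add: phase_pair_def)

lemma twist_add:
  assumes "j \<noteq> k"
  shows "twist j k \<alpha> ** twist j k \<beta> = twist j k (\<alpha> + \<beta>)"
  unfolding twist_def diagonal_mult using assms
  by (intro arg_cong[where f = diagonal]) (auto simp: fun_eq_iff cis_mult add.commute)

text \<open>In the coordinates \<open>j\<close> and \<open>k\<close> the reflection is antidiagonal, since both coordinates of the unit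
  vector have squared modulus 1/2. Products of two such reflections are therefore diagonal.\<close>

lemma refl_matrix_phase_pair_vec:
  assumes "j \<noteq> k"
  shows "(refl_matrix (phase_pair j k \<phi>) *v u) $ i =
    (if i = j then - cis (2 * \<phi>) * u $ k else if i = k then - cis (- 2 * \<phi>) * u $ j else u $ i)"
proof -
  have "cinner (phase_pair j k \<phi>) u = (\<Sum>i\<in>UNIV. if i = j then cis (- \<phi>) / sqrt 2 * u $ j
      else if i = k then cis \<phi> / sqrt 2 * u $ k else 0)"
    unfolding cinner_def by (intro sum.cong) (auto simp: phase_pair_def cis_cnj)
  then have inner: "cinner (phase_pair j k \<phi>) u = (cis (- \<phi>) * u $ j + cis \<phi> * u $ k) / sqrt 2"
    by (simp only: sum_two_points[OF assms]) (simp add: add_divide_distrib)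
  have sq: "complex_of_real (sqrt 2) * complex_of_real (sqrt 2) = 2"
    by (simp flip: of_real_mult)
  have scale: "2 * (x / complex_of_real (sqrt 2)) * (y / complex_of_real (sqrt 2)) = x * y" for x y
    using sq by (simp add: field_simps)
  have one: "cis \<phi> * cis (- \<phi>) = 1" "cis \<phi> * cis \<phi> = cis (2 * \<phi>)"
      "cis (- \<phi>) * cis (- \<phi>) = cis (- 2 * \<phi>)"
    by (simp_all add: cis_mult)
  have "(cis (- \<phi>) * x + cis \<phi> * y) * cis \<phi> = (cis \<phi> * cis (- \<phi>)) * x + (cis \<phi> * cis \<phi>) * y" for x y
    by (simp add: algebra_simps)
  then have "(cis (- \<phi>) * x + cis \<phi> * y) * cis \<phi> = x + cis (2 * \<phi>) * y" for x y
    by (simp only: one mult_1)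
  moreover have "(cis (- \<phi>) * x + cis \<phi> * y) * cis (- \<phi>)
      = (cis (- \<phi>) * cis (- \<phi>)) * x + (cis \<phi> * cis (- \<phi>)) * y" for x y
    by (simp add: algebra_simps)
  then have "(cis (- \<phi>) * x + cis \<phi> * y) * cis (- \<phi>) = cis (- 2 * \<phi>) * x + y" for x y
    by (simp only: one mult_1)
  ultimately show ?thesis
    using assms by (simp add: refl_matrix_mult_vec inner phase_pair_nth scale
        del: times_divide_eq_left times_divide_eq_right)
qed

lemma refl_matrix_phase_pair_product:
  assumes "j \<noteq> k"
  shows "refl_matrix (phase_pair j k \<phi>) ** refl_matrix (phase_pair j k 0) = twist j k (2 * \<phi>)"
  unfolding matrix_eq
  using assms by (auto simp: vec_eq_iff twist_def refl_matrix_phase_pair_vec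
      simp flip: matrix_vector_mul_assoc)

lemma phase_pair_zero: "phase_pair j k 0 = cvec (half_sum j k)" if "j \<noteq> k"
  using that by (simp add: vec_eq_iff phase_pair_nth half_sum_def axis_def)

section \<open>The complex quadratic form on unit vectors\<close>

text \<open>The complex bilinear, not the hermitian, square: it is invariant under real orthogonal matrices
  but not under unitary ones, and so measures how far a unitary matrix is from being orthogonal.\<close>

definition quad :: "complex ^ 'n \<Rightarrow> complex" where
  "quad z = (\<Sum>i\<in>UNIV. (z $ i)\<^sup>2)"

lemma quad_phase_rotation:
  obtains \<mu> where "cmod \<mu> = 1" "\<mu>\<^sup>2 * q = complex_of_real (cmod q)"
proof
  show "cmod (cis (- Arg q / 2)) = 1" by simp
  have "(cis (- Arg q / 2))\<^sup>2 * q = cis (- Arg q) * (complex_of_real (cmod q) * cis (Arg q))"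
    using rcis_cmod_Arg[of q] by (simp add: rcis_def power2_eq_square cis_mult)
  also have "\<dots> = complex_of_real (cmod q)"
    by (simp add: cis_mult mult.left_commute)
  finally show "(cis (- Arg q / 2))\<^sup>2 * q = complex_of_real (cmod q)" .
qed

text \<open>Choose the phase so that the quadratic form of \<open>\<mu> z = x + i y\<close> is real and nonnegative. Then \<open>x\<close> and
  \<open>y\<close> are orthogonal, and the values of \<open>\<bar>x\<bar>\<^sup>2 - \<bar>y\<bar>\<^sup>2\<close> and \<open>\<bar>x\<bar>\<^sup>2 + \<bar>y\<bar>\<^sup>2 = 1\<close> give their lengths
  \<open>\<bar>cos (\<theta> / 2)\<bar>\<close> and \<open>\<bar>sin (\<theta> / 2)\<bar>\<close>. Hence a real orthogonal map takes them to the real and imaginary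
  parts of the normal form, which are multiples of \<open>(e\<^sub>j + e\<^sub>k) / sqrt 2\<close> and \<open>(e\<^sub>j - e\<^sub>k) / sqrt 2\<close>.\<close>

lemma move_to_phase_pair:
  fixes z :: "complex ^ 'n"
  assumes "j \<noteq> k" "cinner z z = 1" "cmod (quad z) = cos \<theta>"
  obtains A \<mu> where "A \<in> orthogonal_in_unitary" "cmod \<mu> = 1"
    "\<mu> *s (A *v z) = phase_pair j k (\<theta> / 2)"
proof -
  obtain \<mu> where \<mu>: "cmod \<mu> = 1" "\<mu>\<^sup>2 * quad z = complex_of_real (cos \<theta>)"
    using quad_phase_rotation[of "quad z"] assms(3) by metis
  define x y :: "real ^ 'n" where "x = (\<chi> i. Re (\<mu> * z $ i))" and "y = (\<chi> i. Im (\<mu> * z $ i))"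
  have "complex_of_real (cos \<theta>) = (\<Sum>i\<in>UNIV. (\<mu> * z $ i)\<^sup>2)"
    unfolding \<mu>(2)[symmetric] quad_def sum_distrib_left by (simp add: power_mult_distrib)
  also have "\<dots> = Complex (x \<bullet> x - y \<bullet> y) (2 * (x \<bullet> y))"
    unfolding inner_vec_def x_def y_def vec_lambda_beta inner_real_def power2_eq_square[symmetric]
    by (simp add: complex_eq_iff Re_power2 Im_power2 sum_subtractf sum_distrib_left mult.assoc
        del: mult.left_commute times_complex.sel)
  finally have diff: "x \<bullet> x - y \<bullet> y = cos \<theta>" and "2 * (x \<bullet> y) = 0"
    by (simp_all only: complex_eq_iff complex.sel Re_complex_of_real Im_complex_of_real)
  then have orth: "x \<bullet> y = 0" by simp
  have "x \<bullet> x + y \<bullet> y = (\<Sum>i\<in>UNIV. (cmod (\<mu> * z $ i))\<^sup>2)"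
    unfolding inner_vec_def x_def y_def vec_lambda_beta inner_real_def power2_eq_square[symmetric]
    by (simp only: cmod_power2 sum.distrib)
  also have "\<dots> = (\<Sum>i\<in>UNIV. (cmod (z $ i))\<^sup>2)"
    by (simp only: norm_mult \<mu>(1) mult_1)
  also have "\<dots> = 1"
  proof -
    have "complex_of_real (\<Sum>i\<in>UNIV. (cmod (z $ i))\<^sup>2) = cinner z z"
      by (simp only: cinner_def of_real_sum complex_norm_square mult.commute)
    then show ?thesis using assms(2) by (metis of_real_eq_1_iff)
  qed
  finally have sum: "x \<bullet> x + y \<bullet> y = 1" .
  define a b :: "real ^ 'n"
    where "a = (\<chi> i. if i = j then 1 / sqrt 2 else if i = k then 1 / sqrt 2 else 0)"
      and "b = (\<chi> i. if i = j then 1 / sqrt 2 else if i = k then - 1 / sqrt 2 else 0)"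
  have ab: "a \<bullet> a = 1" "b \<bullet> b = 1" "a \<bullet> b = 0"
  proof -
    have "a \<bullet> a = (\<Sum>i\<in>UNIV. if i = j then 1 / 2 else if i = k then 1 / 2 else 0)"
      "b \<bullet> b = (\<Sum>i\<in>UNIV. if i = j then 1 / 2 else if i = k then 1 / 2 else 0)"
      "a \<bullet> b = (\<Sum>i\<in>UNIV. if i = j then 1 / 2 else if i = k then - 1 / 2 else 0)"
      unfolding inner_vec_def a_def b_def by (auto intro!: sum.cong)
    then show "a \<bullet> a = 1" "b \<bullet> b = 1" "a \<bullet> b = 0"
      by (simp_all only: sum_two_points[OF assms(1)])
  qed
  define \<phi> where "\<phi> = \<theta> / 2"
  have "\<theta> = 2 * \<phi>" by (simp add: \<phi>_def)
  then have "cos \<theta> = 2 * (cos \<phi>)\<^sup>2 - 1" "cos \<theta> = 1 - 2 * (sin \<phi>)\<^sup>2"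
    using cos_double_cos[of \<phi>] cos_double_sin[of \<phi>] by (simp_all only:)
  then have "x \<bullet> x = (cos \<phi>)\<^sup>2" "y \<bullet> y = (sin \<phi>)\<^sup>2"
    using diff sum by linarith+
  then have "norm x = norm (cos \<phi> *\<^sub>R a)" "norm y = norm (sin \<phi> *\<^sub>R b)"
    unfolding norm_eq using ab by (simp_all add: power2_eq_square)
  moreover have "(cos \<phi> *\<^sub>R a) \<bullet> (sin \<phi> *\<^sub>R b) = 0" using ab by simp
  ultimately obtain f where f: "orthogonal_transformation f" "f x = cos \<phi> *\<^sub>R a" "f y = sin \<phi> *\<^sub>R b"
    using orth orthogonal_pair_transport by metis
  obtain A where A: "A \<in> orthogonal_in_unitary" "\<And>u. A *v cvec u = cvec (f u)"
    using complexify_orthogonal_transformation[OF f(1)] by metis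
  have z: "\<mu> *s z = cvec x + \<i> *s cvec y"
    by (simp add: vec_eq_iff x_def y_def complex_eq_iff)
  have "\<mu> *s (A *v z) = A *v (\<mu> *s z)" by (simp add: vector_scalar_commute)
  also have "\<dots> = cvec (cos \<phi> *\<^sub>R a) + \<i> *s cvec (sin \<phi> *\<^sub>R b)"
    by (simp add: z matrix_vector_right_distrib vector_scalar_commute A(2) f(2,3))
  also have "\<dots> = phase_pair j k \<phi>"
    using assms(1)
    by (auto simp: vec_eq_iff phase_pair_def a_def b_def complex_eq_iff)
  finally show ?thesis using that A(1) \<mu>(1) unfolding \<phi>_def by blast
qed

section \<open>Groups containing the orthogonal matrices and the scalars\<close>

locale group_over_orthogonal =
  fixes H :: "(complex ^ 'n ^ 'n) set"
  assumes unitary: "A \<in> H \<Longrightarrow> unitary_matrix A"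
    and mult_closed: "A \<in> H \<Longrightarrow> B \<in> H \<Longrightarrow> A ** B \<in> H"
    and inverse_closed: "A \<in> H \<Longrightarrow> conj_transpose A \<in> H"
    and orthogonal: "A \<in> orthogonal_in_unitary \<Longrightarrow> A \<in> H"
    and scalar: "cmod c = 1 \<Longrightarrow> mat c \<in> H"
begin

text \<open>The reflection of \<open>U w\<close> lies in the group as a conjugate of a real reflection; after an orthogonal
  change of coordinates it becomes the reflection of a normal form, whose product with a real
  reflection is the twist.\<close>

lemma twist_in_if_cos:
  assumes "U \<in> H" "norm w = 1" "cmod (quad (U *v cvec w)) = cos \<theta>" "j \<noteq> k"
  shows "twist j k \<theta> \<in> H"
proof -
  have "cinner (U *v cvec w) (U *v cvec w) = 1"
    using assms(2) by (simp add: cinner_unitary[OF unitary[OF assms(1)]] cinner_cvec norm_eq_1)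
  then obtain A \<mu> where A: "A \<in> orthogonal_in_unitary" and \<mu>: "cmod \<mu> = 1"
      "\<mu> *s (A *v (U *v cvec w)) = phase_pair j k (\<theta> / 2)"
    using move_to_phase_pair[OF assms(4) _ assms(3)] by metis
  have AU: "A ** U \<in> H" using A assms(1) orthogonal mult_closed by blast
  have "refl_matrix (phase_pair j k (\<theta> / 2)) = refl_matrix ((A ** U) *v cvec w)"
    using \<mu> by (metis refl_matrix_phase matrix_vector_mul_assoc)
  also have "\<dots> = (A ** U) ** refl_matrix (cvec w) ** conj_transpose (A ** U)"
    using conjugate_refl_matrix[OF unitary[OF AU]] by simp
  also have "\<dots> \<in> H"
    using AU orthogonal[OF refl_matrix_in_orthogonal[OF assms(2)]] mult_closed inverse_closed by blast
  finally have "refl_matrix (phase_pair j k (\<theta> / 2)) \<in> H" .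
  moreover have "refl_matrix (phase_pair j k 0) \<in> H"
    using refl_matrix_in_orthogonal[OF norm_half_sum[OF assms(4)]] orthogonal
    by (simp add: phase_pair_zero[OF assms(4)])
  ultimately show ?thesis
    using refl_matrix_phase_pair_product[OF assms(4), of "\<theta> / 2"] mult_closed by force
qed

text \<open>Apply the previous lemma to a twist in place of \<open>U\<close>. On the real unit vectors in the plane of \<open>j\<close>
  and \<open>k\<close> the quadratic form of the image runs through the segment from \<open>exp (2 i \<theta>)\<close> to
  \<open>exp (- 2 i \<theta>)\<close>, that is, through the numbers \<open>cos (2 \<theta>) + i r sin (2 \<theta>)\<close> with
  \<open>\<bar>r\<bar> \<le> 1\<close>, whose moduli fill the interval from \<open>\<bar>cos (2 \<theta>)\<bar>\<close> to 1.\<close>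

lemma small_twist_in:
  assumes "twist j k \<theta> \<in> H" "j \<noteq> k" "sin (2 * \<theta>) \<noteq> 0"
    and "\<bar>cos (2 * \<theta>)\<bar> \<le> cos \<psi>" "j' \<noteq> k'"
  shows "twist j' k' \<psi> \<in> H"
proof -
  define c s where "c = cos (2 * \<theta>)" and "s = sin (2 * \<theta>)"
  have cs: "c\<^sup>2 + s\<^sup>2 = 1" by (simp add: c_def s_def)
  have "s \<noteq> 0" using assms(3) by (simp add: s_def)
  have "c\<^sup>2 \<le> (cos \<psi>)\<^sup>2" using assms(4) unfolding abs_le_square_iff[symmetric] c_def by simp
  have "(cos \<psi>)\<^sup>2 \<le> 1" by (simp add: abs_square_le_1)
  \<comment> \<open>The solution of \<open>c\<^sup>2 + r\<^sup>2 s\<^sup>2 = (cos \<psi>)\<^sup>2\<close>; the hypothesis on \<open>\<psi>\<close> says that it lies between 0 and 1.\<close>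
  define r where "r = sqrt (((cos \<psi>)\<^sup>2 - c\<^sup>2) / s\<^sup>2)"
  have r2: "r\<^sup>2 = ((cos \<psi>)\<^sup>2 - c\<^sup>2) / s\<^sup>2"
    using \<open>c\<^sup>2 \<le> (cos \<psi>)\<^sup>2\<close> by (simp add: r_def)
  have "0 \<le> r" using \<open>c\<^sup>2 \<le> (cos \<psi>)\<^sup>2\<close> by (simp add: r_def)
  moreover have "r\<^sup>2 \<le> 1"
    unfolding r2 using \<open>s \<noteq> 0\<close> \<open>(cos \<psi>)\<^sup>2 \<le> 1\<close> cs by (simp add: divide_le_eq_1)
  ultimately have r: "0 \<le> r" "r \<le> 1" by (simp_all add: abs_square_le_1)
  define w :: "real ^ 'n"
    where "w = (\<chi> i. if i = j then sqrt ((1 + r) / 2) else if i = k then sqrt ((1 - r) / 2) else 0)"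
  have "w \<bullet> w = (\<Sum>i\<in>UNIV. if i = j then (1 + r) / 2 else if i = k then (1 - r) / 2 else 0)"
    unfolding inner_vec_def w_def using r by (auto intro!: sum.cong simp: real_sqrt_mult_self simp del: real_sqrt_divide real_sqrt_mult)
  also have "\<dots> = 1" by (simp only: sum_two_points[OF assms(2)]) (simp add: field_simps)
  finally have "norm w = 1" by (simp add: norm_eq_1)
  have "quad (twist j k \<theta> *v cvec w) = (\<Sum>i\<in>UNIV. if i = j then cis (2 * \<theta>) * ((1 + r) / 2)
      else if i = k then cis (- 2 * \<theta>) * ((1 - r) / 2) else 0)"
  proof -
    have "(complex_of_real (sqrt ((1 + r) / 2)))\<^sup>2 = (1 + r) / 2"
      "(complex_of_real (sqrt ((1 - r) / 2)))\<^sup>2 = (1 - r) / 2"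
      using r by (simp_all del: real_sqrt_divide flip: of_real_power)
    moreover have "(cis \<theta>)\<^sup>2 = cis (2 * \<theta>)" "(cis (- \<theta>))\<^sup>2 = cis (- 2 * \<theta>)"
      by (simp_all add: power2_eq_square cis_mult)
    ultimately show ?thesis
      unfolding quad_def twist_def by (intro sum.cong) (auto simp: w_def power_mult_distrib)
  qed
  also have "\<dots> = Complex c (r * s)"
    by (simp only: sum_two_points[OF assms(2)])
      (simp add: complex_eq_iff c_def s_def field_simps)
  finally have quad: "quad (twist j k \<theta> *v cvec w) = Complex c (r * s)" .
  have "c\<^sup>2 + (r * s)\<^sup>2 = (cos \<psi>)\<^sup>2"
    using \<open>s \<noteq> 0\<close> by (simp add: power_mult_distrib r2)
  then have "cmod (quad (twist j k \<theta> *v cvec w)) = cos \<psi>"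
    using assms(4) unfolding quad by (simp add: complex_norm)
  then show ?thesis using twist_in_if_cos assms(1,5) \<open>norm w = 1\<close> by blast
qed

lemma twist_power_in:
  assumes "twist j k \<psi> \<in> H" "j \<noteq> k"
  shows "twist j k (real m * \<psi>) \<in> H"
proof (induction m)
  case 0
  have "twist j k 0 = mat 1" by (auto simp: twist_def diagonal_def mat_def vec_eq_iff)
  then show ?case using scalar[of 1] by simp
next
  case (Suc m)
  then show ?case
    using mult_closed[OF assms(1) Suc] twist_add[OF assms(2), of \<psi> "real m * \<psi>"]
    by (simp add: algebra_simps)
qed

text \<open>Every angle is an integer multiple of an angle small enough for the previous construction, because
  \<open>\<bar>cos (2 \<theta>)\<bar> < 1\<close>.\<close>

lemma all_twists_in:
  assumes "twist j k \<theta> \<in> H" "j \<noteq> k" "sin (2 * \<theta>) \<noteq> 0" "j' \<noteq> k'"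
  shows "twist j' k' \<alpha> \<in> H"
proof -
  have "(cos (2 * \<theta>))\<^sup>2 + (sin (2 * \<theta>))\<^sup>2 = 1" "(sin (2 * \<theta>))\<^sup>2 > 0"
    using assms(3) by simp_all
  then have "(cos (2 * \<theta>))\<^sup>2 < 1" by linarith
  then have less: "\<bar>cos (2 * \<theta>)\<bar> < 1" by (simp add: abs_square_less_1)
  have "(\<lambda>m. cos (\<alpha> * inverse (real (Suc m)))) \<longlonglongrightarrow> cos (\<alpha> * 0)"
    by (intro tendsto_intros LIMSEQ_inverse_real_of_nat)
  then have "eventually (\<lambda>m. \<bar>cos (2 * \<theta>)\<bar> < cos (\<alpha> * inverse (real (Suc m)))) sequentially"
    using less by (intro order_tendstoD) auto
  then obtain m where m: "\<bar>cos (2 * \<theta>)\<bar> < cos (\<alpha> * inverse (real (Suc m)))"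
    using eventually_happens'[OF sequentially_bot] by blast
  have "twist j' k' (\<alpha> * inverse (real (Suc m))) \<in> H"
    by (rule small_twist_in[OF assms(1-3) less_imp_le[OF m] assms(4)])
  then have "twist j' k' (real (Suc m) * (\<alpha> * inverse (real (Suc m)))) \<in> H"
    using assms(4) by (rule twist_power_in)
  moreover have "real (Suc m) * (\<alpha> * inverse (real (Suc m))) = \<alpha>"
    by (simp del: of_nat_Suc)
  ultimately show ?thesis by (simp only:)
qed

text \<open>A fixed place \<open>s\<close> absorbs the inverse phases: each further entry of \<open>f\<close> costs one twist of its place
  against \<open>s\<close>.\<close>

lemma balanced_diagonal_in:
  assumes "\<And>j k \<alpha>. j \<noteq> k \<Longrightarrow> twist j k \<alpha> \<in> H" "\<And>i. cmod (f i) = 1"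
    and "finite S" "s \<notin> S"
  shows "diagonal (\<lambda>i. if i \<in> S then f i else if i = s then \<Prod>i\<in>S. cnj (f i) else 1) \<in> H"
  using assms(3,4)
proof (induction S)
  case empty
  have "diagonal (\<lambda>i. if i \<in> {} then f i else if i = s then \<Prod>i\<in>{}. cnj (f i) else 1) = mat 1"
    by (simp add: diagonal_const cong: if_cong)
  then show ?case using scalar[of 1] by simp
next
  case (insert t S)
  have "cis (Arg (f t)) = f t" "cis (- Arg (f t)) = cnj (f t)"
    using rcis_cmod_Arg[of "f t"] assms(2)[of t] by (simp_all add: rcis_def flip: cis_cnj)
  then have "diagonal (\<lambda>i. if i \<in> insert t S then f i
      else if i = s then \<Prod>i\<in>insert t S. cnj (f i) else 1)
    = twist t s (Arg (f t))
      ** diagonal (\<lambda>i. if i \<in> S then f i else if i = s then \<Prod>i\<in>S. cnj (f i) else 1)"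
    unfolding twist_def diagonal_mult using insert
    by (intro arg_cong[where f = diagonal]) (auto simp: fun_eq_iff)
  then show ?case using insert assms(1)[of t s] by (auto intro: mult_closed)
qed

text \<open>Twists only generate the diagonal matrices of determinant 1. Dividing \<open>f\<close> by an \<open>n\<close>-th root of its
  product reduces to these, and the root is a scalar of the group.\<close>

lemma diagonal_in:
  assumes "\<And>j k \<alpha>. j \<noteq> k \<Longrightarrow> twist j k \<alpha> \<in> H" "\<And>i. cmod (f i) = 1"
  shows "diagonal f \<in> H"
proof -
  define P where "P = prod f UNIV"
  define c where "c = cis (Arg P / real CARD('n))"
  have "cmod P = 1" by (simp add: P_def assms(2) flip: prod_norm)
  then have "P \<noteq> 0" by auto
  have "c ^ CARD('n) = P"
    using rcis_cmod_Arg[of P] \<open>cmod P = 1\<close> by (simp add: c_def rcis_def Complex.DeMoivre)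
  have c: "cmod c = 1" "c \<noteq> 0" by (simp_all add: c_def)
  define g where "g i = f i / c" for i
  have g: "cmod (g i) = 1" for i by (simp add: g_def norm_divide assms(2) c)
  have "prod g UNIV = 1"
    unfolding g_def prod_dividef P_def[symmetric] using \<open>c ^ CARD('n) = P\<close> \<open>P \<noteq> 0\<close> by simp
  fix s :: 'n
  have inverse: "cnj (g i) = inverse (g i)" for i
    using g[of i] complex_norm_square[of "g i"] by (intro inverse_unique[symmetric]) simp
  have "g s * prod g (UNIV - {s}) = 1"
    using \<open>prod g UNIV = 1\<close> prod.remove[of UNIV s g] by simp
  then have "(\<Prod>i\<in>UNIV - {s}. cnj (g i)) = g s"
    using prod_inversef[of g "UNIV - {s}"] by (simp add: inverse o_def inverse_unique mult.commute)
  then have "diagonal (\<lambda>i. if i \<in> UNIV - {s} then g i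
      else if i = s then \<Prod>i\<in>UNIV - {s}. cnj (g i) else 1) = diagonal g"
    by (intro arg_cong[where f = diagonal]) auto
  moreover have "diagonal (\<lambda>i. if i \<in> UNIV - {s} then g i
      else if i = s then \<Prod>i\<in>UNIV - {s}. cnj (g i) else 1) \<in> H"
    by (rule balanced_diagonal_in[OF assms(1) g]) simp_all
  ultimately have "diagonal g \<in> H" by (simp only:)
  moreover have "diagonal f = mat c ** diagonal g"
    unfolding diagonal_const[symmetric] diagonal_mult using c(2) by (simp add: g_def)
  ultimately show ?thesis using scalar[OF c(1)] mult_closed by simp
qed

text \<open>Here \<open>S\<close> is the set of places whose columns are still to be cleared. To clear column \<open>s\<close>, a diagonal
  unitary makes its entries nonnegative reals, and a real reflection then moves this real unit
  vector to \<open>e\<^sub>s\<close>. Both steps keep the columns outside \<open>S\<close>, because these are standard basis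
  vectors and therefore column \<open>s\<close>, being orthogonal to them, vanishes in the corresponding places.\<close>

lemma unitary_in_by_elimination:
  assumes diagonal: "\<And>f. (\<And>i. cmod (f i) = 1) \<Longrightarrow> diagonal f \<in> H"
    and "finite S" "unitary_matrix U" "\<And>i. i \<notin> S \<Longrightarrow> U *v axis i 1 = axis i 1"
  shows "U \<in> H"
  using assms(2-4)
proof (induction S arbitrary: U)
  case empty
  then have "U $ i $ j = axis j 1 $ i" for i j
    by (simp flip: cvec_axis mult_cvec_axis)
  then have "U = mat 1" by (simp add: vec_eq_iff mat_def axis_def)
  then show ?case using scalar[of 1] by simp
next
  case (insert s S)
  note axis = cvec_axis[symmetric]
  define v where "v = U *v axis s 1"
  have v1: "cinner v v = 1"
    unfolding v_def axis cinner_unitary[OF insert.prems(1)] cinner_cvec by simp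
  have v0: "v $ i = 0" if "i \<notin> insert s S" for i
  proof -
    have "cinner (axis i 1) v = cinner (axis i 1) (axis s 1)"
      using cinner_unitary[OF insert.prems(1), of "axis i 1" "axis s 1"] insert.prems(2)[OF that]
      by (simp add: v_def)
    also have "\<dots> = 0" using that by (auto simp: axis cinner_cvec inner_axis_axis)
    also have "cinner (axis i 1) v = (\<Sum>l\<in>UNIV. if l = i then v $ l else 0)"
      unfolding cinner_def axis_def by (intro sum.cong) auto
    finally show ?thesis by simp
  qed
  \<comment> \<open>The value 1 at the zeros of \<open>v\<close> leaves the columns already cleared untouched.\<close>
  define f where "f i = (if v $ i = 0 then 1 else cnj (v $ i) / cmod (v $ i))" for i
  have f: "cmod (f i) = 1" for i by (simp add: f_def norm_divide)
  define u :: "real ^ 'n" where "u = (\<chi> i. cmod (v $ i))"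
  have "cnj (v $ i) * v $ i = cmod (v $ i) * cmod (v $ i)" for i
    using complex_norm_square[of "v $ i"] by (simp add: power2_eq_square mult.commute)
  then have Dv: "diagonal f *v v = cvec u"
    by (simp add: vec_eq_iff f_def u_def field_simps)
  have "complex_of_real (u \<bullet> u) = cinner (diagonal f *v v) (diagonal f *v v)"
    by (simp add: Dv cinner_cvec)
  also have "\<dots> = 1" by (simp add: cinner_unitary unitary_diagonal f v1)
  finally have "norm u = norm (axis s 1 :: real ^ 'n)" by (simp add: norm_eq_1)
  then obtain h where h: "orthogonal_transformation h" "h u = axis s 1"
      "\<And>x. x \<bullet> (u - axis s 1) = 0 \<Longrightarrow> h x = x"
    using householder by blast
  obtain A where A: "A \<in> orthogonal_in_unitary" "\<And>x. A *v cvec x = cvec (h x)"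
    using complexify_orthogonal_transformation[OF h(1)] by metis
  define B where "B = A ** diagonal f"
  have B: "B \<in> H" unfolding B_def using A(1) f by (intro mult_closed orthogonal diagonal)
  have "(B ** U) *v axis i 1 = axis i 1" if "i \<notin> S" for i
  proof (cases "i = s")
    case True
    then show ?thesis
      by (simp add: B_def Dv A(2) h(2) axis flip: v_def[unfolded axis] matrix_vector_mul_assoc)
  next
    case False
    then have i: "i \<notin> insert s S" using that by simp
    have "(B ** U) *v axis i 1 = A *v (diagonal f *v axis i 1)"
      by (simp add: B_def insert.prems(2)[OF i] flip: matrix_vector_mul_assoc)
    also have "diagonal f *v axis i 1 = cvec (axis i 1)"
      using v0[OF i] by (auto simp: vec_eq_iff axis_def f_def)
    also have "h (axis i 1) = axis i 1"
      using v0[OF i] False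
      by (intro h(3)) (simp add: inner_diff_right inner_axis_axis, simp add: inner_axis' u_def)
    then have "A *v cvec (axis i 1) = axis i 1" by (simp add: A(2) axis)
    finally show ?thesis .
  qed
  then have "B ** U \<in> H"
    using insert.prems(1) unitary[OF B] by (intro insert.IH unitary_matrix_mult)
  with B have "conj_transpose B ** (B ** U) \<in> H" by (rule mult_closed[OF inverse_closed])
  moreover have "conj_transpose B ** (B ** U) = U"
    using unitary[OF B] by (simp add: matrix_mul_assoc unitary_matrix_def)
  ultimately show ?case by simp
qed

end

section \<open>A real vector with an intermediate value of the quadratic form\<close>

text \<open>If the form vanished on the image of the real sphere, polarisation would give \<open>U\<^sup>T U = 0\<close>. The sums of
  two basis vectors used for this are normalised to stay on the sphere.\<close>

lemma isotropic_image_impossible: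
  fixes U :: "complex ^ 'n ^ 'n"
  assumes "unitary_matrix U"
  shows "\<exists>w. norm w = 1 \<and> quad (U *v cvec w) \<noteq> 0"
proof (rule ccontr)
  assume "\<not> ?thesis"
  then have zero: "quad (U *v cvec w) = 0" if "norm w = 1" for w using that by blast
  define M where "M j k = (\<Sum>i\<in>UNIV. U $ i $ j * U $ i $ k)" for j k
  have jj: "M j j = 0" for j
    using zero[of "axis j 1"] by (simp add: quad_def mult_cvec_axis M_def power2_eq_square)
  have "M j k = 0" for j k
  proof (cases "j = k")
    case False
    then have "0 = quad (U *v cvec (half_sum j k))" using zero norm_half_sum by metis
    also have "\<dots> = (\<Sum>i\<in>UNIV. (complex_of_real (1 / sqrt 2))\<^sup>2 * (U $ i $ j + U $ i $ k)\<^sup>2)"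
      by (simp only: quad_def mult_cvec_half_sum power_mult_distrib)
    also have "\<dots> = (M j j + 2 * M j k + M k k) / 2"
      by (simp add: M_def power2_sum sum.distrib sum_distrib_left power_divide algebra_simps
          power2_eq_square sum_divide_distrib flip: of_real_mult)
    finally show ?thesis by (simp add: jj)
  qed (simp add: jj)
  then have "transpose U ** U = 0"
    by (simp add: vec_eq_iff matrix_matrix_mult_def transpose_def M_def)
  moreover have "transpose U = transpose U ** U ** conj_transpose U"
    using assms by (simp add: unitary_matrix_def flip: matrix_mul_assoc)
  ultimately have "transpose U = 0" by simp
  then have "transpose (transpose U) = transpose 0" by simp
  then have "U = 0" by (simp add: transpose_def vec_eq_iff)
  then have "(mat 1 :: complex ^ 'n ^ 'n) = 0" using assms by (simp add: unitary_matrix_def)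
  then have "(mat 1 :: complex ^ 'n ^ 'n) $ i $ i = 0" for i by simp
  then show False by (simp add: mat_def)
qed

text \<open>This is the equality case of the Cauchy-Schwarz inequality for \<open>z\<close> and its complex conjugate: with
  \<open>c = quad z\<close>, the squared distance of \<open>z\<close> and \<open>c\<close> times the conjugate of \<open>z\<close> is \<open>1 - \<bar>c\<bar>\<^sup>2\<close>.\<close>

lemma real_line_if_quad_extremal:
  fixes z :: "complex ^ 'n"
  assumes "cinner z z = 1" "cmod (quad z) \<ge> 1"
  shows "z $ i = quad z * cnj (z $ i)"
proof -
  define c where "c = quad z"
  have sq: "complex_of_real ((cmod x)\<^sup>2) = x * cnj x" for x by (rule complex_norm_square)
  have "complex_of_real (\<Sum>i\<in>UNIV. (cmod (z $ i - c * cnj (z $ i)))\<^sup>2)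
      = (\<Sum>i\<in>UNIV. (z $ i - c * cnj (z $ i)) * cnj (z $ i - c * cnj (z $ i)))"
    by (simp only: of_real_sum sq)
  also have "\<dots> = (\<Sum>i\<in>UNIV. cnj (z $ i) * z $ i + c * cnj c * (cnj (z $ i) * z $ i)
      - cnj c * (z $ i)\<^sup>2 - c * cnj ((z $ i)\<^sup>2))"
    by (intro sum.cong) (auto simp: algebra_simps power2_eq_square)
  also have "\<dots> = cinner z z + c * cnj c * cinner z z - cnj c * quad z - c * cnj (quad z)"
    by (simp only: sum.distrib sum_subtractf cinner_def quad_def sum_distrib_left cnj_sum)
  also have "\<dots> = 1 - c * cnj c" by (simp add: assms(1) c_def)
  also have "\<dots> = complex_of_real (1 - (cmod c)\<^sup>2)" by (simp only: of_real_diff sq of_real_1)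
  finally have "(\<Sum>i\<in>UNIV. (cmod (z $ i - c * cnj (z $ i)))\<^sup>2) = 1 - (cmod c)\<^sup>2"
    by (simp only: of_real_eq_iff)
  also have "\<dots> \<le> 0" using assms(2) by (simp add: c_def)
  finally have "(\<Sum>i\<in>UNIV. (cmod (z $ i - c * cnj (z $ i)))\<^sup>2) = 0"
    by (intro antisym sum_nonneg) auto
  then have "(cmod (z $ i - c * cnj (z $ i)))\<^sup>2 = 0"
    by (subst (asm) sum_nonneg_eq_0_iff) auto
  then show ?thesis by (simp add: c_def)
qed

text \<open>By the equality case, \<open>U w\<close> is for each real unit vector \<open>w\<close> a factor \<open>c w\<close> times the conjugate of
  \<open>U w\<close>. Comparing \<open>w = e\<^sub>j\<close>, \<open>w = e\<^sub>k\<close> and their normalised sum shows that the factor does not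
  depend on the column, since the columns of \<open>U\<close> are linearly independent. Dividing \<open>U\<close> by a square
  root of the common factor makes it real.\<close>

lemma scaled_orthogonal_if_quad_extremal:
  fixes U :: "complex ^ 'n ^ 'n"
  assumes U: "unitary_matrix U" and large: "\<And>w. norm w = 1 \<Longrightarrow> cmod (quad (U *v cvec w)) \<ge> 1"
  shows "\<exists>c A. cmod c = 1 \<and> A \<in> orthogonal_in_unitary \<and> U = mat c ** A"
proof -
  have unit: "cinner (U *v cvec w) (U *v cvec w) = 1" if "norm w = 1" for w
    using that by (simp add: cinner_unitary[OF U] cinner_cvec norm_eq_1)
  define c where "c j = quad (U *v cvec (axis j 1))" for j
  have c: "U $ i $ j = c j * cnj (U $ i $ j)" for i j
    using real_line_if_quad_extremal[OF unit large, of "axis j 1" i] by (simp add: mult_cvec_axis c_def)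
  have ortho: "(\<Sum>i\<in>UNIV. U $ i $ k * cnj (U $ i $ j)) = (if j = k then 1 else 0)" for j k
    using cinner_unitary[OF U, of "cvec (axis j 1)" "cvec (axis k 1)"]
    unfolding cinner_cvec inner_axis_axis
    by (simp only: cinner_def mult_cvec_axis mult.commute) auto
  have const: "c j = c k" for j k
  proof (cases "j = k")
    case False
    define d where "d = quad (U *v cvec (half_sum j k))"
    define r where "r = complex_of_real (1 / sqrt 2)"
    have r: "r \<noteq> 0" "cnj r = r" by (simp_all add: r_def)
    have "r * (U $ i $ j + U $ i $ k) = r * (d * cnj (U $ i $ j + U $ i $ k))" for i
      using real_line_if_quad_extremal[OF unit large, OF norm_half_sum norm_half_sum, OF False False, of i]
      unfolding d_def[symmetric] mult_cvec_half_sum r_def[symmetric] complex_cnj_mult r(2)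
      by (simp only: mult.left_commute)
    then have "U $ i $ j + U $ i $ k = d * cnj (U $ i $ j + U $ i $ k)" for i
      using r(1) mult_left_cancel by blast
    then have eq: "c j * cnj (U $ i $ j) + c k * cnj (U $ i $ k)
        = d * cnj (U $ i $ j) + d * cnj (U $ i $ k)" for i
      using c[of i j] c[of i k] by (metis complex_cnj_add distrib_left)
    have "c l = d" if l: "l = j \<or> l = k" for l
    proof -
      \<comment> \<open>Pairing with column \<open>l\<close> isolates one factor by orthonormality.\<close>
      have "(\<Sum>i\<in>UNIV. U $ i $ l * (c j * cnj (U $ i $ j) + c k * cnj (U $ i $ k)))
          = (\<Sum>i\<in>UNIV. U $ i $ l * (d * cnj (U $ i $ j) + d * cnj (U $ i $ k)))"
        by (simp only: eq)
      then have "c j * (\<Sum>i\<in>UNIV. U $ i $ l * cnj (U $ i $ j)) + c k * (\<Sum>i\<in>UNIV. U $ i $ l * cnj (U $ i $ k))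
          = d * (\<Sum>i\<in>UNIV. U $ i $ l * cnj (U $ i $ j)) + d * (\<Sum>i\<in>UNIV. U $ i $ l * cnj (U $ i $ k))"
        by (simp only: distrib_left sum.distrib sum_distrib_left mult.left_commute)
      then show ?thesis using l False by (auto simp: ortho)
    qed
    then show ?thesis by simp
  qed simp
  fix s :: 'n
  have cs: "U $ i $ j = c s * cnj (U $ i $ j)" for i j using c[of i j] const[of j s] by simp
  have "\<exists>i. U $ i $ s \<noteq> 0"
  proof (rule ccontr)
    assume "\<not> ?thesis"
    then show False using ortho[of s s] by simp
  qed
  then obtain i where "U $ i $ s \<noteq> 0" by blast
  then have "cmod (c s) = 1" using arg_cong[OF cs[of i s], of cmod] by (simp add: norm_mult)
  define \<mu> where "\<mu> = cis (Arg (c s) / 2)"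
  have \<mu>: "cmod \<mu> = 1" "\<mu> * cnj \<mu> = 1" by (simp_all add: \<mu>_def cis_cnj cis_mult)
  have "\<mu> * \<mu> = c s"
    using rcis_cmod_Arg[of "c s"] \<open>cmod (c s) = 1\<close> by (simp add: \<mu>_def cis_mult rcis_def)
  define A where "A = mat (cnj \<mu>) ** U"
  have "cnj (A $ i $ j) = A $ i $ j" for i j
  proof -
    have "A $ i $ j = cnj \<mu> * (\<mu> * \<mu> * cnj (U $ i $ j))"
      using cs[of i j] \<open>\<mu> * \<mu> = c s\<close> by (simp add: A_def)
    also have "\<dots> = (\<mu> * cnj \<mu>) * (\<mu> * cnj (U $ i $ j))" by (simp only: mult_ac)
    finally show ?thesis by (simp add: \<mu>(2)) (simp add: A_def)
  qed
  then have "A $ i $ j \<in> \<real>" for i j by (simp add: Reals_cnj_iff)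
  moreover have "mat (cnj \<mu>) \<in> scalar_unitaries"
    using \<mu>(1) unfolding scalar_unitaries_def by (intro CollectI exI[of _ "cnj \<mu>"]) simp
  then have "unitary_matrix A"
    unfolding A_def using U by (rule unitary_matrix_mult[OF scalar_unitaries_unitary])
  ultimately have "A \<in> orthogonal_in_unitary" by (simp add: orthogonal_in_unitary_iff)
  moreover have "U = mat \<mu> ** A"
    by (simp add: A_def matrix_mul_assoc mat_mult_mat \<mu>(2))
  ultimately show ?thesis using \<mu>(1) by blast
qed

text \<open>On the connected unit sphere the form can neither vanish identically nor have modulus at least 1
  everywhere, by the two preceding exclusions.\<close>

lemma intermediate_quad:
  fixes U :: "complex ^ 'n ^ 'n"
  assumes "CARD('n) \<ge> 2" "unitary_matrix U"
    and "\<not> (\<exists>c A. cmod c = 1 \<and> A \<in> orthogonal_in_unitary \<and> U = mat c ** A)"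
  obtains w where "norm w = 1" "0 < cmod (quad (U *v cvec w))" "cmod (quad (U *v cvec w)) < 1"
proof -
  define F where "F w = cmod (quad (U *v cvec w))" for w
  have "continuous_on (sphere 0 1) F"
    unfolding F_def quad_def cvec_def matrix_vector_mult_def
    by (simp, intro continuous_intros)
  moreover have "connected (sphere (0 :: real ^ 'n) 1)"
    using assms(1) by (intro connected_sphere) simp
  ultimately have conn: "connected (F ` sphere 0 1)" by (rule connected_continuous_image)
  obtain w0 where w0: "norm w0 = 1" "0 < F w0"
    using isotropic_image_impossible[OF assms(2)] by (auto simp: F_def)
  obtain w1 where w1: "norm w1 = 1" "F w1 < 1"
    using scaled_orthogonal_if_quad_extremal[OF assms(2)] assms(3) by (force simp: F_def)
  show ?thesis
  proof (cases "0 < F w1 \<or> F w0 < 1")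
    case True
    then show ?thesis using that w0 w1 unfolding F_def by blast
  next
    case False
    \<comment> \<open>Here \<open>F w1 = 0\<close> and \<open>F w0 \<ge> 1\<close>, and 1/2 serves as a value in between.\<close>
    then have "1/2 \<in> {F w1..F w0}" by simp
    then have "1/2 \<in> F ` sphere 0 1"
      using connected_contains_Icc[OF conn, of "F w1" "F w0"] w0 w1 by auto
    then obtain w where "norm w = 1" "F w = 1/2" by auto
    then show ?thesis using that[of w] unfolding F_def by (auto simp del: zero_less_norm_iff)
  qed
qed

section \<open>Maximality\<close>

lemma (in group_over_orthogonal) scaled_orthogonal_or_all:
  assumes "CARD('n) \<ge> 2"
  shows "(\<forall>U\<in>H. \<exists>c A. cmod c = 1 \<and> A \<in> orthogonal_in_unitary \<and> U = mat c ** A)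
    \<or> (\<forall>U. unitary_matrix U \<longrightarrow> U \<in> H)"
proof (rule disjCI)
  assume "\<not> (\<forall>U. unitary_matrix U \<longrightarrow> U \<in> H)"
  then obtain V where V: "unitary_matrix V" "V \<notin> H" by blast
  show "\<forall>U\<in>H. \<exists>c A. cmod c = 1 \<and> A \<in> orthogonal_in_unitary \<and> U = mat c ** A"
  proof (intro ballI, rule ccontr)
    fix U
    assume U: "U \<in> H" and "\<not> (\<exists>c A. cmod c = 1 \<and> A \<in> orthogonal_in_unitary \<and> U = mat c ** A)"
    then obtain w where w: "norm w = 1" "0 < cmod (quad (U *v cvec w))" "cmod (quad (U *v cvec w)) < 1"
      using intermediate_quad[OF assms unitary[OF U]] by blast
    define \<theta> where "\<theta> = arccos (cmod (quad (U *v cvec w)))"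
    have cos: "cos \<theta> = cmod (quad (U *v cvec w))"
      unfolding \<theta>_def using w by (intro cos_arccos) (auto intro: order_trans[OF _ norm_ge_zero])
    have "\<bar>cos \<theta>\<bar> < 1" using w cos by simp
    then have "(cos \<theta>)\<^sup>2 < 1" by (simp add: abs_square_less_1)
    then have "sin \<theta> \<noteq> 0" using sin_squared_eq[of \<theta>] by auto
    then have "sin (2 * \<theta>) \<noteq> 0" using w(2) cos by (simp add: sin_double)
    obtain j k :: 'n where "j \<noteq> k"
      using assms card_le_Suc0_iff_eq[of "UNIV :: 'n set"] by auto
    have "twist j k \<theta> \<in> H" using twist_in_if_cos[OF U w(1)] cos \<open>j \<noteq> k\<close> by simp
    then have "twist j' k' \<alpha> \<in> H" if "j' \<noteq> k'" for j' k' \<alpha>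
      using all_twists_in \<open>j \<noteq> k\<close> \<open>sin (2 * \<theta>) \<noteq> 0\<close> that by blast
    then have "diagonal f \<in> H" if "\<And>i. cmod (f i) = 1" for f
      using diagonal_in that by blast
    then show False using unitary_in_by_elimination[of UNIV V] V by simp
  qed
qed

lemma projectivization_scalar:
  assumes "cmod c = 1"
  shows "projectivization (mat c) = \<one>\<^bsub>projective_unitary_group\<^esub>"
proof -
  have c: "mat c \<in> scalar_unitaries" using assms by (auto simp: scalar_unitaries_def)
  then have "projectivization (mat c) = scalar_unitaries"
    unfolding projectivization_def
    using normal_imp_subgroup[OF normal_scalar_unitaries]
    by (intro group.coset_join2 group_unitary_group) (auto simp: scalar_unitaries_unitary)
  then show ?thesis by (simp add: projective_unitary_group_def FactGroup_def)
qed

lemma projectivization_scalar_mult: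
  assumes "cmod c = 1" "unitary_matrix A"
  shows "projectivization (mat c ** A) = projectivization A"
proof -
  have "unitary_matrix (mat c :: complex ^ 'n ^ 'n)"
    using assms(1) by (intro scalar_unitaries_unitary) (auto simp: scalar_unitaries_def)
  then have "projectivization (mat c ** A)
      = projectivization (mat c) \<otimes>\<^bsub>projective_unitary_group\<^esub> projectivization A"
    using hom_mult[OF projectivization_hom, of "mat c" A] assms(2) by simp
  also have "projectivization A \<in> carrier projective_unitary_group"
    using assms(2) by (simp add: carrier_projective_unitary_group)
  then have "projectivization (mat c) \<otimes>\<^bsub>projective_unitary_group\<^esub> projectivization A = projectivization A"
    using monoid.l_one[OF group.is_monoid[OF group_projective_unitary_group]]
    by (simp add: projectivization_scalar[OF assms(1)])
  finally show ?thesis .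
qed

lemma group_over_orthogonal_preimage:
  fixes G :: "(complex ^ 'n ^ 'n) set set"
  assumes G: "subgroup G projective_unitary_group" and "projective_orthogonal \<subseteq> G"
  shows "group_over_orthogonal {U. unitary_matrix U \<and> projectivization U \<in> G}"
proof -
  interpret G: subgroup G "projective_unitary_group" by (rule G)
  interpret P: group_hom "unitary_group :: (complex ^ 'n ^ 'n) monoid" projective_unitary_group projectivization
    by (simp add: group_hom_def group_hom_axioms_def group_unitary_group group_projective_unitary_group
        projectivization_hom)
  have one: "projectivization (mat c :: complex ^ 'n ^ 'n) = \<one>\<^bsub>projective_unitary_group\<^esub>" if "cmod c = 1" for c
    using that by (rule projectivization_scalar)
  show ?thesis
  proof
    fix A :: "complex ^ 'n ^ 'n"
    assume A: "A \<in> {U. unitary_matrix U \<and> projectivization U \<in> G}"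
    then show "unitary_matrix A" by simp
    have "conj_transpose A = inv\<^bsub>unitary_group\<^esub> A"
      using A by (intro P.G.inv_equality[symmetric]) (auto simp: unitary_matrix_def)
    then have "projectivization (conj_transpose A) = inv\<^bsub>projective_unitary_group\<^esub> projectivization A"
      using A by simp
    then show "conj_transpose A \<in> {U. unitary_matrix U \<and> projectivization U \<in> G}"
      using A by (simp add: unitary_matrix_def)
    fix B :: "complex ^ 'n ^ 'n"
    assume B: "B \<in> {U. unitary_matrix U \<and> projectivization U \<in> G}"
    then have "projectivization (A ** B)
        = projectivization A \<otimes>\<^bsub>projective_unitary_group\<^esub> projectivization B"
      using A P.hom_mult[of A B] by simp
    then show "A ** B \<in> {U. unitary_matrix U \<and> projectivization U \<in> G}"
      using A B by (simp add: unitary_matrix_mult)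
  next
    fix A :: "complex ^ 'n ^ 'n"
    assume "A \<in> orthogonal_in_unitary"
    then show "A \<in> {U. unitary_matrix U \<and> projectivization U \<in> G}"
      using assms(2) by (auto simp: orthogonal_in_unitary_iff projective_orthogonal_def)
  next
    fix c :: complex
    assume c: "cmod c = 1"
    then have "unitary_matrix (mat c :: complex ^ 'n ^ 'n)"
      by (intro scalar_unitaries_unitary) (auto simp: scalar_unitaries_def)
    then show "mat c \<in> {U. unitary_matrix U \<and> projectivization U \<in> G}"
      using one[OF c] by simp
  qed
qed

theorem theorem2p7:
  fixes G :: "(complex ^ 'n ^ 'n) set set"
  assumes "CARD('n) \<ge> 2"
    and "subgroup G projective_unitary_group"
    and "compactin projective_unitary_topology G"
    and "projective_orthogonal \<subseteq> G"
    and "G \<subseteq> carrier projective_unitary_group"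
  shows "G = projective_orthogonal \<or> G = carrier projective_unitary_group"
proof -
  define H where "H = {U. unitary_matrix U \<and> projectivization U \<in> G}"
  interpret group_over_orthogonal H
    unfolding H_def using assms(2,4) by (rule group_over_orthogonal_preimage)
  have G: "X \<in> G \<Longrightarrow> \<exists>U\<in>H. X = projectivization U" for X
    using subsetD[OF assms(5), of X] by (auto simp: H_def carrier_projective_unitary_group)
  from scaled_orthogonal_or_all[OF assms(1)] show ?thesis
  proof
    assume *: "\<forall>U\<in>H. \<exists>c A. cmod c = 1 \<and> A \<in> orthogonal_in_unitary \<and> U = mat c ** A"
    have "G \<subseteq> projective_orthogonal"
    proof
      fix X
      assume "X \<in> G"
      then obtain U where "U \<in> H" "X = projectivization U" using G by blast
      moreover from this obtain c A where "cmod c = 1" "A \<in> orthogonal_in_unitary" "U = mat c ** A"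
        using * by blast
      ultimately have "cmod c = 1" "A \<in> orthogonal_in_unitary" "X = projectivization (mat c ** A)"
        by simp_all
      then show "X \<in> projective_orthogonal"
        by (simp add: projective_orthogonal_def orthogonal_in_unitary_iff projectivization_scalar_mult)
    qed
    then show ?thesis using assms(4) by blast
  next
    assume "\<forall>U. unitary_matrix U \<longrightarrow> U \<in> H"
    then have "carrier projective_unitary_group \<subseteq> G"
      by (auto simp: H_def carrier_projective_unitary_group)
    then show ?thesis using assms(5) by blast
  qed
qed

end
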